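(* Let $\mathbb D=\langle D,\leq_{\mathbb D}\rangle$ be a directed set such that Player II has no winning strategy in the game $\mathcal G(\mathbb D)$. If $\mathbb I$ is an inverse system of sets over $\mathbb D$ whose inverse limit $A_{\mathbb I}$ is non-empty, then the inverse limit $G_{\mathbb I_{ab}}$ is a free abelian group of cardinality $\max\{\aleph_0,|A_{\mathbb I}|\}$.
   Context: A directed set is a pair $\langle D,\leq_{\mathbb D}\rangle$ with $\leq_{\mathbb D}$ reflexive and transitive on $D$ such that any two elements have a common upper bound. An inverse system of sets over $\mathbb D$ is $\mathbb I=\langle\langle A_p: p\in D\rangle,\langle f_{p,q}: p\leq_{\mathbb D} q\rangle\rangle$ with each $A_p$ non-empty, $f_{p,q}:A_q\to A_p$, $f_{p,p}=\mathrm{id}$, $f_{p,q}\circ f_{q,r}=f_{p,r}$ for $p\leq q\leq r$; its inverse limit is $A_{\mathbb I}=\{(a_p)_{p\in D}: f_{p,q}(a_q)=a_p\text{ for all }p\leq_{\mathbb D} q\}$. $\mathbb I_{ab}$ is the inverse system of groups where $H_p$ is the free abelian group with basis $\{x_{p,a}: a\in A_p\}$ and $h_{p,q}:H_q\to H_p$ is the homomorphism with $h_{p,q}(x_{q,a})=x_{p,f_{p,q}(a)}$; its inverse limit is $G_{\mathbb I_{ab}}=\{(g_p)\in\prod_p H_p: h_{p,q}(g_q)=g_p\text{ for all }p\leq_{\mathbb D} q\}$. The game $\mathcal G(\mathbb D)$: in round $i<\omega$, Player I chooses $p_{2i}\in D$ and then Player II chooses $p_{2i+1}\in D$. Player I wins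 the run $(p_i)_{i<\omega}$ iff either there is $i$ with $p_{2i}\not\leq_{\mathbb D} p_{2i+1}$, or $p_{2i+1}\leq_{\mathbb D}p_{2i+2}$ for all $i<\omega$ and there is $p\in D$ with $p_i\leq_{\mathbb D} p$ for all $i$. A winning strategy for Player II is a function $s:{}^{<\omega}D\to D$ such that Player II wins every run with $s(\langle p_0,\dots,p_{2i}\rangle)=p_{2i+1}$ for all $i$. *)

theory Defs
  imports "HOL-Algebra.Free_Abelian_Groups"
begin

unbundle cardinal_syntax

text \<open>Directed sets are non-empty, as usual. For the empty index set the inverse limit of sets
  would be a singleton and that of groups trivial.\<close>

locale directed_set =
  fixes D :: "'d set" and leq :: "'d \<Rightarrow> 'd \<Rightarrow> bool"
  assumes nonempty: "D \<noteq> {}"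
    and refl: "reflp_on D leq"
    and trans: "transp_on D leq"
    and directed: "\<And>p q. p \<in> D \<Longrightarrow> q \<in> D \<Longrightarrow> \<exists>r\<in>D. leq p r \<and> leq q r"

text \<open>All sets \<open>A p\<close> live in a single type; they need not be disjoint.
  The maps \<open>f p q\<close> only matter for \<open>leq p q\<close>, and only on \<open>A q\<close>.\<close>

locale inverse_system = directed_set D leq
  for D :: "'d set" and leq :: "'d \<Rightarrow> 'd \<Rightarrow> bool" +
  fixes A :: "'d \<Rightarrow> 'a set" and f :: "'d \<Rightarrow> 'd \<Rightarrow> 'a \<Rightarrow> 'a"
  assumes A_nonempty: "\<And>p. p \<in> D \<Longrightarrow> A p \<noteq> {}"
    and f_maps: "\<And>p q. p \<in> D \<Longrightarrow> q \<in> D \<Longrightarrow> leq p q \<Longrightarrow> f p q \<in> A q \<rightarrow> A p"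
    and f_id: "\<And>p a. p \<in> D \<Longrightarrow> a \<in> A p \<Longrightarrow> f p p a = a"
    and f_comp: "\<And>p q r a. p \<in> D \<Longrightarrow> q \<in> D \<Longrightarrow> r \<in> D \<Longrightarrow> leq p q \<Longrightarrow> leq q r \<Longrightarrow> a \<in> A r
                  \<Longrightarrow> f p q (f q r a) = f p r a"

definition inverse_limit ::
    "'d set \<Rightarrow> ('d \<Rightarrow> 'd \<Rightarrow> bool) \<Rightarrow> ('d \<Rightarrow> 'a set) \<Rightarrow> ('d \<Rightarrow> 'd \<Rightarrow> 'a \<Rightarrow> 'a) \<Rightarrow> ('d \<Rightarrow> 'a) set" where
  "inverse_limit D leq A f =
     {a \<in> (\<Pi>\<^sub>E p\<in>D. A p). \<forall>p\<in>D. \<forall>q\<in>D. leq p q \<longrightarrow> f p q (a q) = a p}"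

definition inverse_limit_group ::
    "'d set \<Rightarrow> ('d \<Rightarrow> 'd \<Rightarrow> bool) \<Rightarrow> ('d \<Rightarrow> 'g monoid) \<Rightarrow> ('d \<Rightarrow> 'd \<Rightarrow> 'g \<Rightarrow> 'g) \<Rightarrow> ('d \<Rightarrow> 'g) monoid"
  where
  "inverse_limit_group D leq H h =
     (product_group D H)\<lparr>carrier := inverse_limit D leq (\<lambda>p. carrier (H p)) h\<rparr>"

text \<open>The generator \<open>x\<^bsub>p,a\<^esub>\<close> of the free abelian group over \<open>A p\<close> is \<open>frag_of a\<close>.\<close>

definition ab_map :: "('d \<Rightarrow> 'd \<Rightarrow> 'a \<Rightarrow> 'a) \<Rightarrow> 'd \<Rightarrow> 'd \<Rightarrow> ('a \<Rightarrow>\<^sub>0 int) \<Rightarrow> ('a \<Rightarrow>\<^sub>0 int)" where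
  "ab_map f p q = frag_extend (\<lambda>a. frag_of (f p q a))"

definition ab_limit ::
    "'d set \<Rightarrow> ('d \<Rightarrow> 'd \<Rightarrow> bool) \<Rightarrow> ('d \<Rightarrow> 'a set) \<Rightarrow> ('d \<Rightarrow> 'd \<Rightarrow> 'a \<Rightarrow> 'a)
      \<Rightarrow> ('d \<Rightarrow> ('a \<Rightarrow>\<^sub>0 int)) monoid" where
  "ab_limit D leq A f = inverse_limit_group D leq (\<lambda>p. free_Abelian_group (A p)) (ab_map f)"

text \<open>Restricting \<open>S\<close> to the element type of \<open>G\<close> is no loss of generality, because a basis
  of \<open>G\<close> consists of elements of \<open>G\<close>.\<close>

definition is_free_abelian :: "'g monoid \<Rightarrow> bool" where
  "is_free_abelian G \<longleftrightarrow> comm_group G \<and> (\<exists>S :: 'g set. G \<cong> free_Abelian_group S)"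

definition player_I_wins :: "'d set \<Rightarrow> ('d \<Rightarrow> 'd \<Rightarrow> bool) \<Rightarrow> (nat \<Rightarrow> 'd) \<Rightarrow> bool" where
  "player_I_wins D leq p \<longleftrightarrow>
     (\<exists>i. \<not> leq (p (2 * i)) (p (2 * i + 1))) \<or>
     ((\<forall>i. leq (p (2 * i + 1)) (p (2 * i + 2))) \<and> (\<exists>q\<in>D. \<forall>i. leq (p i) q))"

definition winning_strategy_II :: "'d set \<Rightarrow> ('d \<Rightarrow> 'd \<Rightarrow> bool) \<Rightarrow> ('d list \<Rightarrow> 'd) \<Rightarrow> bool" where
  "winning_strategy_II D leq s \<longleftrightarrow>
     s \<in> lists D \<rightarrow> D \<and>
     (\<forall>p :: nat \<Rightarrow> 'd. range p \<subseteq> D \<longrightarrow> (\<forall>i. s (map p [0..<2 * i + 1]) = p (2 * i + 1)) \<longrightarrow>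
        \<not> player_I_wins D leq p)"

text \<open>\<open>t = max {r, s}\<close> for cardinals given as relations on different types.\<close>

definition card_eq_max :: "'c rel \<Rightarrow> 'a rel \<Rightarrow> 'b rel \<Rightarrow> bool" where
  "card_eq_max t r s \<longleftrightarrow> (if r \<le>o s then t =o s else t =o r)"

lemma ab_map_frag_of: "ab_map f p q (frag_of a) = frag_of (f p q a)"
  by (simp add: ab_map_def)

context inverse_system
begin

lemma ab_map_hom:
  assumes "p \<in> D" "q \<in> D" "leq p q"
  shows "ab_map f p q \<in> hom (free_Abelian_group (A q)) (free_Abelian_group (A p))"
proof (rule homI)
  fix c assume "c \<in> carrier (free_Abelian_group (A q))"
  then have c: "Poly_Mapping.keys c \<subseteq> A q" by (simp add: carrier_free_Abelian_group_iff)
  have "Poly_Mapping.keys (ab_map f p q c) \<subseteq> (\<Union>x\<in>Poly_Mapping.keys c. Poly_Mapping.keys (frag_of (f p q x)))"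
    unfolding ab_map_def by (rule keys_frag_extend)
  also have "\<dots> \<subseteq> A p" using c f_maps[OF assms] by auto
  finally show "ab_map f p q c \<in> carrier (free_Abelian_group (A p))"
    by (simp add: carrier_free_Abelian_group_iff)
qed (simp add: ab_map_def frag_extend_add)

lemma subgroup_ab_limit:
  "subgroup (inverse_limit D leq (\<lambda>p. carrier (free_Abelian_group (A p))) (ab_map f))
     (product_group D (\<lambda>p. free_Abelian_group (A p)))"
proof -
  interpret P: group "product_group D (\<lambda>p. free_Abelian_group (A p))"
    by simp
  show ?thesis
  proof (rule P.subgroupI)
    show "inverse_limit D leq (\<lambda>p. carrier (free_Abelian_group (A p))) (ab_map f) \<noteq> {}"
      by (auto simp: inverse_limit_def ab_map_def carrier_free_Abelian_group_iff
               intro!: exI[of _ "\<lambda>p\<in>D. 0"])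
  qed (auto simp: inverse_limit_def ab_map_def frag_extend_add frag_extend_minus inv_product_group
                  PiE_iff extensional_def carrier_free_Abelian_group_iff
            dest!: subsetD[OF Poly_Mapping.keys_add])
qed

lemma comm_group_ab_limit: "comm_group (ab_limit D leq A f)"
proof -
  have "group (product_group D (\<lambda>p. free_Abelian_group (A p)))"
    by simp
  then interpret group "ab_limit D leq A f"
    unfolding ab_limit_def inverse_limit_group_def
    by (rule subgroup.subgroup_is_group[OF subgroup_ab_limit])
  show ?thesis
    by (rule group_comm_groupI)
       (simp add: ab_limit_def inverse_limit_group_def product_group_def add.commute)
qed

end

end

theory Submission
  imports Defs
begin

text \<open>
  For \<open>g\<close> in the limit group, the support of \<open>g\<^sub>p\<close> is contained in the image of the support of
  \<open>g\<^sub>q\<close> whenever \<open>p \<le> q\<close>, so the size of the support grows with the index. If it were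
  unbounded, Player II would win by answering in round \<open>i\<close> with an index of support size at
  least \<open>i\<close>. So it attains its maximum at some \<open>m\<close>, and above \<open>m\<close> the bonding maps restrict to
  bijections between the supports. Each point of the support of \<open>g\<^sub>m\<close> therefore extends to a
  thread in the inverse limit of sets, and \<open>g\<close> is the corresponding combination of threads.
  Finitely many threads are separated at a single index, hence threads are linearly independent,
  and the limit group is free on the inverse limit of sets.
\<close>

section \<open>Homomorphisms of free abelian groups induced by maps of generators\<close>

lemma frag_extend_frag_of_compose:
  "frag_extend (\<lambda>b. frag_of (\<phi> b)) (frag_extend (\<lambda>a. frag_of (\<psi> a)) c)
     = frag_extend (\<lambda>a. frag_of (\<phi> (\<psi> a))) c"
  using frag_extend_compose[of "\<lambda>b. frag_of (\<phi> b)" \<psi>] by (simp add: comp_def fun_eq_iff)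

lemma frag_extend_frag_of_ident:
  assumes "\<And>a. a \<in> Poly_Mapping.keys c \<Longrightarrow> \<phi> a = a"
  shows "frag_extend (\<lambda>a. frag_of (\<phi> a)) c = c"
  using frag_extend_eq[of c "\<lambda>a. frag_of (\<phi> a)" frag_of] assms
  by (simp flip: frag_expansion)

lemma keys_frag_extend_frag_of:
  "Poly_Mapping.keys (frag_extend (\<lambda>a. frag_of (\<phi> a)) c) \<subseteq> \<phi> ` Poly_Mapping.keys c"
  using keys_frag_extend[of "\<lambda>a. frag_of (\<phi> a)" c] by auto

text \<open>The homomorphism induced by \<open>inv_into S \<phi>\<close> is a left inverse, by
  functoriality.\<close>

lemma inj_on_frag_extend_frag_of:
  fixes \<phi> :: "'a \<Rightarrow> 'b"
  assumes "inj_on \<phi> S"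
  shows "inj_on (frag_extend (\<lambda>a. frag_of (\<phi> a))) {c. Poly_Mapping.keys c \<subseteq> S}"
proof (rule inj_on_inverseI)
  fix c :: "'a \<Rightarrow>\<^sub>0 int" assume "c \<in> {c. Poly_Mapping.keys c \<subseteq> S}"
  then show "frag_extend (\<lambda>b. frag_of (inv_into S \<phi> b)) (frag_extend (\<lambda>a. frag_of (\<phi> a)) c) = c"
    unfolding frag_extend_frag_of_compose
    by (intro frag_extend_frag_of_ident) (auto simp: assms inv_into_f_f)
qed

text \<open>Serves to rename generators: \<open>is_free_abelian\<close> wants a set \<open>S\<close>
  in the element type of the group, while the natural generators of the limit group are threads,
  which have another type.\<close>

lemma free_Abelian_group_iso_bij_betw:
  fixes \<phi> :: "'a \<Rightarrow> 'b"
  assumes "bij_betw \<phi> S T"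
  shows "free_Abelian_group S \<cong> free_Abelian_group T"
proof -
  let ?h = "frag_extend (\<lambda>a. frag_of (\<phi> a))"
  have inj: "inj_on \<phi> S" and T: "T = \<phi> ` S"
    using assms by (auto simp: bij_betw_def)
  have "?h ` {c. Poly_Mapping.keys c \<subseteq> S} = {c. Poly_Mapping.keys c \<subseteq> T}"
  proof (intro equalityI subsetI)
    fix c assume "c \<in> ?h ` {c. Poly_Mapping.keys c \<subseteq> S}"
    then show "c \<in> {c. Poly_Mapping.keys c \<subseteq> T}"
      using keys_frag_extend_frag_of[of \<phi>] T by fastforce
  next
    fix c :: "'b \<Rightarrow>\<^sub>0 int" assume "c \<in> {c. Poly_Mapping.keys c \<subseteq> T}"
    then have c: "Poly_Mapping.keys c \<subseteq> \<phi> ` S" using T by simp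
    let ?c = "frag_extend (\<lambda>b. frag_of (inv_into S \<phi> b)) c"
    have "?h ?c = c"
      unfolding frag_extend_frag_of_compose
      by (rule frag_extend_frag_of_ident) (use c in \<open>auto simp: f_inv_into_f\<close>)
    moreover have "Poly_Mapping.keys ?c \<subseteq> S"
      using keys_frag_extend_frag_of[of "inv_into S \<phi>" c] c inv_into_into[of _ \<phi> S] by blast
    ultimately show "c \<in> ?h ` {c. Poly_Mapping.keys c \<subseteq> S}"
      by (metis (mono_tags) image_eqI mem_Collect_eq)
  qed
  then have "?h \<in> iso (free_Abelian_group S) (free_Abelian_group T)"
    using inj_on_frag_extend_frag_of[OF inj]
    by (auto simp: iso_def hom_def bij_betw_def free_Abelian_group_def frag_extend_add)
  then show ?thesis
    by (auto simp: is_iso_def)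
qed

section \<open>Cardinality of free abelian groups\<close>

lemma card_of_free_Abelian_group_countable:
  assumes "countable S"
  shows "|carrier (free_Abelian_group S)| \<le>o natLeq"
proof -
  \<comment> \<open>Numbering the generators embeds the group into one with a countably infinite
    basis, and a free abelian group on an infinite basis has the size of that basis.\<close>
  let ?N = "free_Abelian_group (UNIV :: nat set)"
  obtain \<phi> :: "_ \<Rightarrow> nat" where "inj_on \<phi> S"
    using assms by (auto simp: countable_def)
  then have "inj_on (frag_extend (\<lambda>a. frag_of (\<phi> a))) (carrier (free_Abelian_group S))"
    using inj_on_frag_extend_frag_of by (simp add: free_Abelian_group_def)
  then have "|carrier (free_Abelian_group S)| \<le>o |carrier ?N|"
    by (rule card_of_ordLeqI) simp
  also have "|carrier ?N| =o |UNIV :: nat set|"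
    using eqpoll_free_Abelian_group_infinite[OF infinite_UNIV_nat]
    by (simp add: eqpoll_iff_card_of_ordIso)
  also have "|UNIV :: nat set| =o natLeq"
    by (rule card_of_nat)
  finally show ?thesis .
qed

lemma infinite_carrier_free_Abelian_group:
  assumes "S \<noteq> {}"
  shows "infinite (carrier (free_Abelian_group S))"
proof -
  obtain x where x: "x \<in> S" using assms by blast
  \<comment> \<open>The multiples of one generator already suffice; the coefficient at
    \<open>x\<close> recovers \<open>n\<close>.\<close>
  have "inj (\<lambda>n::int. frag_cmul n (frag_of x))"
    by (rule injI, drule arg_cong[where f = "\<lambda>c. Poly_Mapping.lookup c x"]) simp
  moreover have "range (\<lambda>n::int. frag_cmul n (frag_of x)) \<subseteq> carrier (free_Abelian_group S)"
    using x keys_cmul by fastforce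
  ultimately show ?thesis
    using infinite_UNIV_int infinite_super range_inj_infinite finite_imageD by blast
qed

text \<open>A non-empty finite basis yields a countably infinite group, an infinite basis a group of
  its own size. \<open>S \<noteq> {}\<close> excludes the trivial group.\<close>

lemma card_eq_max_free_Abelian_group:
  assumes "S \<noteq> {}"
  shows "card_eq_max |carrier (free_Abelian_group S)| natLeq |S|"
proof -
  have natLeq_iff: "natLeq \<le>o |X| \<longleftrightarrow> infinite X" for X :: "'x set"
    using infinite_iff_natLeq_ordLeq by blast
  show ?thesis
  proof (cases "finite S")
    case True
    have "|carrier (free_Abelian_group S)| =o natLeq"
      using card_of_free_Abelian_group_countable[OF countable_finite[OF True]]
        infinite_carrier_free_Abelian_group[OF assms]
      unfolding ordIso_iff_ordLeq natLeq_iff by blast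
    then show ?thesis
      unfolding card_eq_max_def natLeq_iff using True by simp
  next
    case False
    then show ?thesis
      unfolding card_eq_max_def natLeq_iff
      using eqpoll_free_Abelian_group_infinite[OF False] by (simp add: eqpoll_iff_card_of_ordIso)
  qed
qed

section \<open>Directed sets and the game\<close>

context directed_set
begin

lemma leq_refl: "p \<in> D \<Longrightarrow> leq p p"
  using refl by (rule reflp_onD)

lemma leq_trans: "leq p q \<Longrightarrow> leq q r \<Longrightarrow> p \<in> D \<Longrightarrow> q \<in> D \<Longrightarrow> r \<in> D \<Longrightarrow> leq p r"
  using trans by (blast dest: transp_onD)

lemma finite_upper_bound:
  assumes "finite P" "P \<subseteq> D"
  shows "\<exists>q\<in>D. \<forall>p\<in>P. leq p q"
  using assms
proof (induction P rule: finite_induct)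
  case empty
  then show ?case using nonempty by blast
next
  case (insert x P)
  then obtain q where q: "q \<in> D" "\<forall>p\<in>P. leq p q" by auto
  moreover obtain r where "r \<in> D" "leq x r" "leq q r"
    using directed[of x q] insert.prems q by auto
  ultimately have "\<forall>p\<in>insert x P. leq p r"
    using insert.prems leq_trans[of _ q r] by auto
  with \<open>r \<in> D\<close> show ?case by blast
qed

text \<open>This is how the game hypothesis is used: it forces a monotone \<open>N\<close> to be
  constant above some index. The supports of a group element will supply \<open>N\<close>.\<close>

lemma monotone_nat_attains_max:
  fixes N :: "'d \<Rightarrow> nat"
  assumes no_win: "\<nexists>s. winning_strategy_II D leq s"
    and mono: "\<And>p q. p \<in> D \<Longrightarrow> q \<in> D \<Longrightarrow> leq p q \<Longrightarrow> N p \<le> N q"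
  obtains m where "m \<in> D" "\<And>q. q \<in> D \<Longrightarrow> leq m q \<Longrightarrow> N q = N m"
proof (cases "\<exists>B. \<forall>p\<in>D. N p \<le> B")
  case True
  then have "finite (N ` D)"
    by (auto simp: finite_nat_set_iff_bounded_le)
  then have "Max (N ` D) \<in> N ` D"
    using nonempty by simp
  then obtain m where m: "m \<in> D" "N m = Max (N ` D)" by auto
  show ?thesis
  proof
    show "N q = N m" if "q \<in> D" "leq m q" for q
      using mono[OF m(1) that] m(2) \<open>finite (N ` D)\<close> that(1)
      by (simp add: antisym)
  qed (rule m(1))
next
  case False
  \<comment> \<open>An index with a large value need not lie above \<open>p\<close>, but a common
    upper bound does, and monotonicity keeps its value large.\<close>
  have ex: "\<exists>q\<in>D. leq p q \<and> n < N q" if p: "p \<in> D" for p n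
  proof -
    obtain r where r: "r \<in> D" "n < N r" using False by (metis not_le)
    obtain q where "q \<in> D" "leq p q" "leq r q" using directed p r by blast
    then show ?thesis using mono[of r q] r by auto
  qed
  obtain d where d: "d \<in> D" using nonempty by blast
  define t where "t p n = (SOME q. q \<in> D \<and> leq p q \<and> n < N q)" for p n
  have t: "t p n \<in> D \<and> leq p (t p n) \<and> n < N (t p n)" if "p \<in> D" for p n
    unfolding t_def by (rule someI_ex) (use ex[OF that, of n] in blast)
  \<comment> \<open>In a run only lists of length \<open>2 * i + 1\<close> are queried, so
    \<open>d\<close> is an arbitrary default. The length exceeds the round number \<open>i\<close>,
    so it can serve as the threshold.\<close>
  define s where "s xs = (if xs = [] then d else t (last xs) (length xs))" for xs
  have "winning_strategy_II D leq s"
    unfolding winning_strategy_II_def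
  proof (intro conjI allI impI)
    show "s \<in> lists D \<rightarrow> D"
      using d t by (auto simp: s_def in_lists_conv_set)
    fix p :: "nat \<Rightarrow> 'd"
    assume p: "range p \<subseteq> D" and run: "\<forall>i. s (map p [0..<2 * i + 1]) = p (2 * i + 1)"
    have step: "leq (p (2 * i)) (p (2 * i + 1)) \<and> i < N (p (2 * i + 1))" for i
    proof -
      have "p (2 * i + 1) = t (p (2 * i)) (2 * i + 1)"
        using run[rule_format, of i] by (simp add: s_def)
      then show ?thesis
        using t[of "p (2 * i)" "2 * i + 1"] p by (auto simp: image_subset_iff)
    qed
    \<comment> \<open>Player II's answer in round \<open>N q\<close> has a value above
      \<open>N q\<close>, so \<open>q\<close> cannot bound the run.\<close>
    have "\<not> (\<forall>i. leq (p i) q)" if q: "q \<in> D" for q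
    proof
      assume "\<forall>i. leq (p i) q"
      then have "N (p (2 * N q + 1)) \<le> N q"
        using mono[OF _ q] p by (simp add: image_subset_iff)
      then show False using step[of "N q"] by simp
    qed
    then show "\<not> player_I_wins D leq p"
      using step by (auto simp: player_I_wins_def)
  qed
  then show ?thesis using no_win by blast
qed

end

section \<open>Threads and the comparison homomorphism\<close>

context inverse_system
begin

text \<open>Threads that differ at some index differ at every larger one, since the bonding map
  recovers the earlier values. So an upper bound of one distinguishing index for each of the
  finitely many pairs works.\<close>

lemma inverse_limit_separated:
  assumes fin: "finite K" and K: "K \<subseteq> inverse_limit D leq A f"
  shows "\<exists>p\<in>D. inj_on (\<lambda>a. a p) K"
proof -
  have lim: "a \<in> Pi\<^sub>E D A" "\<And>p q. p \<in> D \<Longrightarrow> q \<in> D \<Longrightarrow> leq p q \<Longrightarrow> f p q (a q) = a p"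
    if "a \<in> K" for a
    using subsetD[OF K that] by (simp_all add: inverse_limit_def)
  have "\<exists>p\<in>D. a p \<noteq> b p" if "a \<in> K" "b \<in> K" "a \<noteq> b" for a b
    using PiE_ext[OF lim(1)[OF that(1)] lim(1)[OF that(2)]] that(3) by blast
  then obtain w where w: "\<And>a b. a \<in> K \<Longrightarrow> b \<in> K \<Longrightarrow> a \<noteq> b \<Longrightarrow> w a b \<in> D \<and> a (w a b) \<noteq> b (w a b)"
    by metis
  let ?P = "(\<lambda>(a, b). w a b) ` {(a, b) \<in> K \<times> K. a \<noteq> b}"
  have "finite ?P"
    by (rule finite_imageI, rule finite_subset[of _ "K \<times> K"]) (auto simp: fin)
  moreover have "?P \<subseteq> D" using w by auto
  ultimately obtain q where q: "q \<in> D" "\<forall>p\<in>?P. leq p q"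
    using finite_upper_bound by blast
  have "a = b" if ab: "a \<in> K" "b \<in> K" "a q = b q" for a b
  proof (rule ccontr)
    assume "a \<noteq> b"
    then have p: "w a b \<in> D" "leq (w a b) q" "a (w a b) \<noteq> b (w a b)"
      using w ab q by auto
    have "f (w a b) q (a q) = a (w a b)" "f (w a b) q (b q) = b (w a b)"
      using lim(2)[OF ab(1) p(1) q(1) p(2)] lim(2)[OF ab(2) p(1) q(1) p(2)] .
    then show False using p ab by simp
  qed
  then show ?thesis using q by (auto simp: inj_on_def)
qed

text \<open>The canonical homomorphism from the free group on the limit to the limit of the free
  groups, induced at each index by evaluation of threads. Restriction to \<open>D\<close> puts its
  values into the extensional product.\<close>

definition thread_map :: "(('d \<Rightarrow> 'a) \<Rightarrow>\<^sub>0 int) \<Rightarrow> 'd \<Rightarrow> ('a \<Rightarrow>\<^sub>0 int)" where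
  "thread_map c = (\<lambda>p\<in>D. frag_extend (\<lambda>a. frag_of (a p)) c)"

lemma carrier_ab_limit_iff:
  "g \<in> carrier (ab_limit D leq A f) \<longleftrightarrow>
     g \<in> extensional D \<and> (\<forall>p\<in>D. Poly_Mapping.keys (g p) \<subseteq> A p) \<and>
     (\<forall>p\<in>D. \<forall>q\<in>D. leq p q \<longrightarrow> ab_map f p q (g q) = g p)"
  unfolding ab_limit_def inverse_limit_group_def inverse_limit_def
  by (simp add: PiE_iff) blast

lemma thread_map_compatible:
  assumes c: "Poly_Mapping.keys c \<subseteq> inverse_limit D leq A f"
    and pq: "p \<in> D" "q \<in> D" "leq p q"
  shows "ab_map f p q (thread_map c q) = thread_map c p"
proof -
  have "frag_extend (\<lambda>a. frag_of (f p q (a q))) c = frag_extend (\<lambda>a. frag_of (a p)) c"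
    by (rule frag_extend_eq) (use c pq in \<open>auto simp: inverse_limit_def\<close>)
  then show ?thesis
    using pq by (simp add: thread_map_def ab_map_def frag_extend_frag_of_compose)
qed

lemma thread_map_closed:
  assumes "Poly_Mapping.keys c \<subseteq> inverse_limit D leq A f"
  shows "thread_map c \<in> carrier (ab_limit D leq A f)"
proof -
  have "Poly_Mapping.keys (thread_map c p) \<subseteq> A p" if "p \<in> D" for p
    using assms that keys_frag_extend_frag_of[of "\<lambda>a. a p" c]
    by (fastforce simp: thread_map_def inverse_limit_def)
  then show ?thesis
    using thread_map_compatible[OF assms]
    by (simp add: carrier_ab_limit_iff) (simp add: thread_map_def)
qed

text \<open>At an index separating all threads in the two supports, evaluation is injective on these
  generators and hence on their combinations.\<close>

lemma thread_map_inj: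
  "inj_on thread_map {c. Poly_Mapping.keys c \<subseteq> inverse_limit D leq A f}"
proof (rule inj_onI)
  fix c c' assume "c \<in> {c. Poly_Mapping.keys c \<subseteq> inverse_limit D leq A f}"
    "c' \<in> {c. Poly_Mapping.keys c \<subseteq> inverse_limit D leq A f}"
    and eq: "thread_map c = thread_map c'"
  then obtain p where p: "p \<in> D" "inj_on (\<lambda>a. a p) (Poly_Mapping.keys c \<union> Poly_Mapping.keys c')"
    using inverse_limit_separated[of "Poly_Mapping.keys c \<union> Poly_Mapping.keys c'"] by auto
  show "c = c'"
    using fun_cong[OF eq, of p] p(1) inj_onD[OF inj_on_frag_extend_frag_of[OF p(2)], of c c']
    by (simp add: thread_map_def)
qed

text \<open>The threads are built from the supports \<open>K p\<close> of \<open>g p\<close>: above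
  a suitable \<open>m\<close> each support point has exactly one lift, and an index not above
  \<open>m\<close> gets its value from a larger index.\<close>

lemma thread_map_surj:
  assumes no_win: "\<nexists>s. winning_strategy_II D leq s"
    and g: "g \<in> carrier (ab_limit D leq A f)"
  obtains c where "Poly_Mapping.keys c \<subseteq> inverse_limit D leq A f" "thread_map c = g"
proof -
  define K where "K p = Poly_Mapping.keys (g p)" for p
  have fin: "finite (K p)" for p by (simp add: K_def)
  have K_A: "K p \<subseteq> A p" if "p \<in> D" for p
    using g that by (simp add: K_def carrier_ab_limit_iff)
  have g_map: "ab_map f p q (g q) = g p" if "p \<in> D" "q \<in> D" "leq p q" for p q
    using g that by (simp add: carrier_ab_limit_iff)
  have K_sub: "K p \<subseteq> f p q ` K q" if "p \<in> D" "q \<in> D" "leq p q" for p q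
    using keys_frag_extend_frag_of[of "f p q" "g q"] g_map[OF that] by (simp add: K_def ab_map_def)
  have "card (K p) \<le> card (K q)" if "p \<in> D" "q \<in> D" "leq p q" for p q
    using surj_card_le[OF fin K_sub[OF that]] .
  then obtain m where m: "m \<in> D" and max: "\<And>q. q \<in> D \<Longrightarrow> leq m q \<Longrightarrow> card (K q) = card (K m)"
    using monotone_nat_attains_max[OF no_win, of "\<lambda>p. card (K p)"] by metis
  \<comment> \<open>The image of \<open>K q\<close> contains \<open>K p\<close> and has at most
    \<open>card (K q) = card (K p)\<close> points, so it equals \<open>K p\<close> and no two points
    of \<open>K q\<close> collapse.\<close>
  have bij: "bij_betw (f p q) (K q) (K p)"
    if "p \<in> D" "q \<in> D" "leq m p" "leq p q" for p q
  proof -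
    have card: "card (K q) = card (K p)"
      using max[of p] max[of q] that m leq_trans[of m p q] by simp
    have "card (f p q ` K q) \<le> card (K p)"
      using card_image_le[OF fin, of "f p q" q] card by simp
    then have "K p = f p q ` K q"
      using card_seteq[OF finite_imageI[OF fin] K_sub[OF that(1,2,4)]] by blast
    then show ?thesis
      using card by (auto simp: bij_betw_def fin intro: eq_card_imp_inj_on)
  qed
  have lift_ex: "\<exists>!b. b \<in> K q \<and> f m q b = x" if "q \<in> D" "leq m q" "x \<in> K m" for q x
    using bij[OF m that(1) leq_refl[OF m] that(2)] that(3)
    unfolding bij_betw_def inj_on_def by (metis (no_types, lifting) imageE)
  define lift where "lift q x = (THE b. b \<in> K q \<and> f m q b = x)" for q x
  have lift: "lift q x \<in> K q" "f m q (lift q x) = x" if "q \<in> D" "leq m q" "x \<in> K m" for q x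
    using theI'[OF lift_ex[OF that]] by (auto simp: lift_def)
  have lift_eq: "lift q x = b" if "q \<in> D" "leq m q" "x \<in> K m" "b \<in> K q" "f m q b = x" for q x b
    using lift_ex[of q x] lift[of q x] that by blast
  \<comment> \<open>By uniqueness of lifts: the left side also lies in \<open>K p\<close> and lies
    over \<open>x\<close>.\<close>
  have lift_compat: "f p q (lift q x) = lift p x"
    if "p \<in> D" "q \<in> D" "leq m p" "leq p q" "x \<in> K m" for p q x
  proof (rule lift_eq[symmetric])
    have mq: "leq m q" using leq_trans m that by blast
    show "f p q (lift q x) \<in> K p"
      using bij[OF that(1-4)] lift(1)[OF that(2) mq that(5)] by (auto simp: bij_betw_def)
    show "f m p (f p q (lift q x)) = x"
      using f_comp[of m p q "lift q x"] lift[OF that(2) mq that(5)] K_A that m by auto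
  qed (use that in auto)
  \<comment> \<open>Lifts are controlled only above \<open>m\<close>, so the value of a thread at
    \<open>r\<close> is projected from an index above both \<open>m\<close> and
    \<open>r\<close>.\<close>
  define u where "u r = (SOME q. q \<in> D \<and> leq m q \<and> leq r q)" for r
  have u: "u r \<in> D \<and> leq m (u r) \<and> leq r (u r)" if "r \<in> D" for r
    unfolding u_def by (rule someI_ex) (use directed m that in blast)
  define t where "t x = (\<lambda>r\<in>D. f r (u r) (lift (u r) x))" for x
  \<comment> \<open>Independence of the choice of \<open>u r\<close>: both candidates are
    projections of the lift at a common upper bound \<open>v\<close>.\<close>
  have t_eq: "t x r = f r q (lift q x)"
    if r: "r \<in> D" and q: "q \<in> D" "leq m q" "leq r q" and x: "x \<in> K m" for r q x
  proof -
    have ur: "u r \<in> D" "leq m (u r)" "leq r (u r)" using u r by auto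
    obtain v where v: "v \<in> D" "leq (u r) v" "leq q v" using directed ur q by blast
    have "leq m v" using leq_trans m v q by blast
    then have A: "lift v x \<in> A v" using lift(1)[of v x] K_A v x by auto
    have "f r (u r) (lift (u r) x) = f r v (lift v x)"
      using lift_compat[of "u r" v x] f_comp[of r "u r" v "lift v x"] ur v r x A by simp
    moreover have "f r q (lift q x) = f r v (lift v x)"
      using lift_compat[of q v x] f_comp[of r q v "lift v x"] q v r x A by simp
    ultimately show ?thesis using r by (simp add: t_def)
  qed
  have t_lim: "t x \<in> inverse_limit D leq A f" if x: "x \<in> K m" for x
    unfolding inverse_limit_def
  proof (intro CollectI conjI ballI impI)
    show "t x \<in> (\<Pi>\<^sub>E p\<in>D. A p)"
    proof (rule PiE_I)
      fix r assume r: "r \<in> D"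
      then show "t x r \<in> A r"
        using u[OF r] lift(1)[of "u r" x] x K_A[of "u r"] f_maps[of r "u r"] by (auto simp: t_def)
    qed (simp add: t_def)
    fix p q assume pq: "p \<in> D" "q \<in> D" "leq p q"
    have uq: "u q \<in> D" "leq m (u q)" "leq q (u q)" using u pq by auto
    have "t x p = f p (u q) (lift (u q) x)" "t x q = f q (u q) (lift (u q) x)"
      using t_eq[of _ "u q" x] pq uq x leq_trans[of p q "u q"] by auto
    then show "f p q (t x q) = t x p"
      using f_comp[of p q "u q" "lift (u q) x"] lift(1)[of "u q" x] K_A[of "u q"] pq uq x by auto
  qed
  \<comment> \<open>The coefficients are those of \<open>g m\<close>, with each support point
    \<open>x\<close> replaced by the thread through it.\<close>
  define c where "c = frag_extend (\<lambda>x. frag_of (t x)) (g m)"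
  have c: "Poly_Mapping.keys c \<subseteq> inverse_limit D leq A f"
    using keys_frag_extend_frag_of[of t "g m"] t_lim by (auto simp: c_def K_def)
  \<comment> \<open>Writing \<open>g m\<close> as the image of \<open>g q\<close> reduces this to
    generators: a point \<open>a\<close> of \<open>K q\<close> is the value at \<open>q\<close> of
    the thread through \<open>f m q a\<close>.\<close>
  have above: "thread_map c q = g q" if q: "q \<in> D" "leq m q" for q
  proof -
    have "thread_map c q = frag_extend (\<lambda>x. frag_of (t x q)) (ab_map f m q (g q))"
      using q g_map[OF m q] by (simp add: thread_map_def c_def frag_extend_frag_of_compose)
    also have "\<dots> = frag_extend (\<lambda>a. frag_of (t (f m q a) q)) (g q)"
      by (simp add: ab_map_def frag_extend_frag_of_compose)
    also have "\<dots> = g q"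
    proof (rule frag_extend_frag_of_ident)
      fix a assume "a \<in> Poly_Mapping.keys (g q)"
      then have a: "a \<in> K q" by (simp add: K_def)
      have x: "f m q a \<in> K m"
        using bij[OF m q(1) leq_refl[OF m] q(2)] a by (auto simp: bij_betw_def)
      have "t (f m q a) q = f q q (lift q (f m q a))"
        using t_eq[OF q(1) q leq_refl[OF q(1)] x] .
      also have "\<dots> = f q q a"
        using lift_eq[OF q x a] by simp
      finally show "t (f m q a) q = a"
        using f_id[of q a] K_A[of q] a q by auto
    qed
    finally show ?thesis .
  qed
  have "thread_map c = g"
  proof (rule extensionalityI[of _ D])
    fix r assume r: "r \<in> D"
    \<comment> \<open>Compatible families that agree at \<open>q\<close> agree at every index below
      \<open>q\<close>.\<close>
    then obtain q where q: "q \<in> D" "leq m q" "leq r q" using directed m by blast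
    then show "thread_map c r = g r"
      using above thread_map_compatible[OF c r] g_map[OF r] by metis
  qed (use g in \<open>simp_all add: thread_map_def carrier_ab_limit_iff\<close>)
  with c show ?thesis by (rule that)
qed

lemma thread_map_iso:
  assumes "\<nexists>s. winning_strategy_II D leq s"
  shows "thread_map \<in> iso (free_Abelian_group (inverse_limit D leq A f)) (ab_limit D leq A f)"
proof -
  let ?F = "free_Abelian_group (inverse_limit D leq A f)"
  have "thread_map (c + c') = thread_map c \<otimes>\<^bsub>ab_limit D leq A f\<^esub> thread_map c'" for c c'
    by (auto simp: thread_map_def ab_limit_def inverse_limit_group_def product_group_def
        frag_extend_add)
  then have "thread_map \<in> hom ?F (ab_limit D leq A f)"
    by (intro homI) (simp_all add: thread_map_closed)
  moreover have "thread_map ` carrier ?F = carrier (ab_limit D leq A f)"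
  proof (intro equalityI subsetI)
    fix g assume "g \<in> carrier (ab_limit D leq A f)"
    then show "g \<in> thread_map ` carrier ?F"
      by (rule thread_map_surj[OF assms]) auto
  qed (auto simp: thread_map_closed)
  ultimately show ?thesis
    using thread_map_inj by (simp add: iso_def bij_betw_def free_Abelian_group_def)
qed

lemma inj_on_thread_basis:
  "inj_on (\<lambda>a. thread_map (frag_of a)) (inverse_limit D leq A f)"
proof (rule inj_onI)
  fix a b assume "a \<in> inverse_limit D leq A f" "b \<in> inverse_limit D leq A f"
    "thread_map (frag_of a) = thread_map (frag_of b)"
  then show "a = b"
    using inj_onD[OF thread_map_inj, of "frag_of a" "frag_of b"] by (simp add: frag_of_eq)
qed

end

section \<open>Freeness and cardinality of the limit group\<close>

theorem theorem3p2:
  fixes D :: "'d set" and leq :: "'d \<Rightarrow> 'd \<Rightarrow> bool"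
    and A :: "'d \<Rightarrow> 'a set" and f :: "'d \<Rightarrow> 'd \<Rightarrow> 'a \<Rightarrow> 'a"
  assumes "directed_set D leq"
    and "\<not> (\<exists>s. winning_strategy_II D leq s)"
    and "inverse_system D leq A f"
    and "inverse_limit D leq A f \<noteq> {}"
  shows "is_free_abelian (ab_limit D leq A f) \<and>
         card_eq_max |carrier (ab_limit D leq A f)| natLeq |inverse_limit D leq A f|"
proof
  interpret inverse_system D leq A f by fact
  let ?L = "inverse_limit D leq A f"
  let ?G = "ab_limit D leq A f"
  have iso: "free_Abelian_group ?L \<cong> ?G"
    using thread_map_iso[OF assms(2)] by (auto simp: is_iso_def)
  then have "?G \<cong> free_Abelian_group ?L"
    by (simp add: group.iso_sym)
  \<comment> \<open>Each thread is replaced by its image in \<open>?G\<close>, which gives a basis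
    of the required type.\<close>
  also have "free_Abelian_group ?L \<cong> free_Abelian_group ((\<lambda>a. thread_map (frag_of a)) ` ?L)"
    by (rule free_Abelian_group_iso_bij_betw[OF inj_on_imp_bij_betw[OF inj_on_thread_basis]])
  finally show "is_free_abelian ?G"
    using comm_group_ab_limit by (auto simp: is_free_abelian_def)
  have "|carrier ?G| =o |carrier (free_Abelian_group ?L)|"
    using iso_imp_eqpoll_carrier[OF iso] by (simp add: eqpoll_iff_card_of_ordIso ordIso_symmetric)
  then show "card_eq_max |carrier ?G| natLeq |?L|"
    using card_eq_max_free_Abelian_group[OF assms(4)]
    by (simp add: card_eq_max_def ordIso_transitive[of "|carrier ?G|"] split: if_splits)
qed

end
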